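(* Let $\psi_0\in F$ be a fixed reference field, let $m,n\in\mathbb{N}_0$ be large enough indices such that the regularized master Dyson--Schwinger operator is a Hilbert--Schmidt operator $\mathbf{M}_{\psi_0}: H_m\otimes_{\mathrm{HS}}F_n\to H_0$, and let $\hat{\mathbf{M}}^2_{\psi_0}:H_m\to H_m$ be the associated positive trace class operator (all as defined in the context). Let $P$ denote the orthogonal projection in $H_m$ onto $\mathrm{Ker}(\hat{\mathbf{M}}^2_{\psi_0})$. Then for every real $T>0$ which is not smaller than the operator norm of $\hat{\mathbf{M}}^2_{\psi_0}$, with the notation $\mathcal{P}:=I-T^{-1}\hat{\mathbf{M}}^2_{\psi_0}$, the operator sequence $k\mapsto\mathcal{P}^k$ converges strongly (pointwise) to $P$ in $H_m$.
   Context: **Fields.** $\mathcal{M}$ is a compact finite dimensional smooth oriented manifold, with or without boundary (if there is a boundary, it has the cone property). $F$ is the affine space of smooth sections of a real finite dimensional affine bundle over $\mathcal{M}$; $\mathbb{F}$ is the real vector space of smooth sections of the subordinate vector bundle, with its $C^\infty$ topology (a nuclear Fréchet space). $\mathbb{F}_T\subset\mathbb{F}$ is either $\mathbb{F}$ itself or the closed subspace of sections vanishing on $\partial\mathcal{M}$ together with all derivatives. There is a real-complex splitting $\mathbb{F}=\mathbb{F}_r\oplus\mathbb{F}_c$ into closed subspaces with $\mathbb{F}_c$ carrying a complex structure; $\mathbb{F}_{(\mathbb{C})}:=(\mathbb{F}_r\otimes\mathbb{C})\oplus\mathbb{F}_c$, which contains $\mathbb{F}$ as a real subspace. There is a splitting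 $\mathbb{F}=\bigoplus_{i=1}^f\mathbb{F}_i$ into closed flavor sectors, each contained in $\mathbb{F}_r$ or in $\mathbb{F}_c$, with labels $s_i\in\{0,1\}$ (bosonic/fermionic). $\mathbb{F}_T$ respects these splittings. **Field algebra.** Both $\mathbb{F}_{(\mathbb{C})}$ and $\mathbb{F}_T$ are countably Hilbert nuclear Fréchet spaces: their topologies are defined by sequences $\|\cdot\|_0,\|\cdot\|_1,\dots$, respectively $\|\cdot\|^F_0,\|\cdot\|^F_1,\dots$, of increasing Hilbertian norms of Sobolev type, such that the completions are nested in each other and the inclusions between distant enough completions are Hilbert--Schmidt (and eventually nuclear). $F_n$ denotes the Hilbert space completion of $\mathbb{F}_T$ in $\|\cdot\|^F_n$. The analytic tensor algebra $\mathcal{T}_h(\mathbb{F}_{(\mathbb{C})})$ is the space of sequences $G=(G^{(0)},G^{(1)},\dots)$ with $G^{(n)}\in\bigotimes^n\mathbb{F}_{(\mathbb{C})}$ (completed tensor products) for which all of the norms $\|G\|_m:=\big(\sum_{n\ge0}2^{mn}(\|G^{(n)}\|_m^{\otimes n})^2\big)^{1/2}$, $m\in\mathbb{N}_0$, are finite, with the topology defined by these norms, where $\|\cdot\|_m^{\otimes n}$ is the Hilbertian cross norm. A permutation $\pi$ of $n$ symbols acts on $\bigotimes^n\mathbb{F}_{(\mathbb{C})}$ by $U_\pi(x_1\otimes\cdots\otimes x_n)=(-1)^{\sum_i s_i\sigma_i(\pi)}x_{\pi(1)}\otimes\cdots\otimes x_{\pi(n)}$ when each $x_j$ lies in a single flavor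 sector, where $\sigma_i(\pi)\in\{0,1\}$ is the parity of the permutation among the factors lying in the $i$-th sector. Let $P^{\mathrm{sym}}_n=\frac1{n!}\sum_\pi U_\pi$. The field algebra is the closed subspace $\mathcal{H}:=A(\mathbb{F}_{(\mathbb{C})})\subset\mathcal{T}_h(\mathbb{F}_{(\mathbb{C})})$ of all $G$ with $P^{\mathrm{sym}}_nG^{(n)}=G^{(n)}$ for all $n$; it is again a countably Hilbert nuclear Fréchet space. $H_m$ is the Hilbert space completion of $\mathcal{H}$ in $\|\cdot\|_m$, with scalar product $\langle\cdot,\cdot\rangle_m$. **Regularized MDS operator.** $\hbar$ is a fixed real number. $E:F\times\mathbb{F}_T\to\mathbb{R}$, $(\psi,\delta\psi_T)\mapsto(E(\psi)|\delta\psi_T)$ is an Euler--Lagrange functional of a classical field theory: it is jointly sequentially continuous and linear in the second variable. It is assumed that there is an element $\mathbf{E}_{\psi_0}\in\mathcal{H}^*\otimes\mathbb{F}_T^*$ (${}^*$ = strong dual) with $(E(\psi)|\delta\psi_T)=\big(\mathbf{E}_{\psi_0}\,\big|\,(1,\psi-\psi_0,\bigotimes^2(\psi-\psi_0),\dots)\otimes\delta\psi_T\big)$ for all $\psi\in F$, $\delta\psi_T\in\mathbb{F}_T$ (this includes the multipolynomial functionals). Contracting the last entry with $\delta\psi_T$ gives $(\mathbf{E}_{\psi_0}|\delta\psi_T)\in\mathcal{H}^*$. For $p=(p^{(0)},p^{(1)},\dots)\in\mathcal{H}^*$, the left insertion operator $\iota_p$ is the continuous linear operator on $\mathcal{H}$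 with $(\iota_pG)^{(n)}=\sum_k\big(p^{(k)}\text{ contracted with the first }k\text{ tensor entries of }G^{(n+k)}\big)$. For $u\in\mathbb{F}_{(\mathbb{C})}$, $L_u$ is the left multiplication operator on $\mathcal{H}$, $(L_uG)^{(n+1)}=(n+1)P^{\mathrm{sym}}_{n+1}(u\otimes G^{(n)})$, $(L_uG)^{(0)}=0$. $\kappa$ is a fixed mollifying kernel, i.e. $C_\kappa:\mathbb{F}\to\mathbb{F}$ is an integral operator with smooth properly supported kernel (a properly supported smoothing operator) preserving the flavor sectors. The regularized MDS operator is the continuous linear map $\mathbf{M}_{\psi_0}:\mathcal{H}\otimes\mathbb{F}_T\to\mathcal{H}$, $\mathbf{M}_{\psi_0}(G\otimes\delta\psi_T)=\big(\iota_{(\mathbf{E}_{\psi_0}|\delta\psi_T)}-\mathrm{i}\hbar L_{C_\kappa\delta\psi_T}\big)G$. **Hilbert space version.** For all large enough $m,n$, $\mathbf{M}_{\psi_0}$ extends continuously to a Hilbert--Schmidt operator $H_m\otimes_{\mathrm{HS}}F_n\to H_0$, denoted by the same symbol ($\otimes_{\mathrm{HS}}$ = Hilbert--Schmidt, i.e. Hilbert space, tensor product); such $m,n$ are fixed. For an orthonormal basis $(e_i)_{i\in I}$ of $F_n$, the form $B(G_1,G_2)=\sum_{i\in I}\langle\mathbf{M}_{\psi_0}(G_1\otimes e_i),\mathbf{M}_{\psi_0}(G_2\otimes e_i)\rangle_{H_0}$ is a continuous positive semidefinite sesquilinear form on $H_m$ which is independent of the basis, and $\hat{\mathbf{M}}^2_{\psi_0}:H_m\to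 H_m$ is the unique continuous linear operator with $B(G_1,G_2)=\langle G_1,\hat{\mathbf{M}}^2_{\psi_0}G_2\rangle_m$ for all $G_1,G_2\in H_m$; it is positive and trace class. *)

theory Defs
  imports
    "HOL-Analysis.Analysis"
    "HOL-Combinatorics.Combinatorics"
    "HOL-Library.Function_Algebras"
begin

section \<open>Complex vector spaces and complex Hilbert spaces\<close>

text \<open>
  The scalar product is antilinear in its first and linear in its second argument.
\<close>

class complex_vec = real_vector +
  fixes scaleC :: "complex \<Rightarrow> 'a \<Rightarrow> 'a"  (infixr "*\<^sub>C" 75)
  assumes scaleC_add_right: "c *\<^sub>C (x + y) = c *\<^sub>C x + c *\<^sub>C y"
    and scaleC_add_left: "(c + d) *\<^sub>C x = c *\<^sub>C x + d *\<^sub>C x"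
    and scaleC_scaleC: "c *\<^sub>C d *\<^sub>C x = (c * d) *\<^sub>C x"
    and scaleC_of_real: "complex_of_real r *\<^sub>C x = r *\<^sub>R x"

class complex_hilbert = complex_vec + real_inner + complete_space +
  fixes cinner :: "'a \<Rightarrow> 'a \<Rightarrow> complex"
  assumes cinner_commute: "cinner x y = cnj (cinner y x)"
    and cinner_add_right: "cinner x (y + z) = cinner x y + cinner x z"
    and cinner_scaleC_right: "cinner x (c *\<^sub>C y) = c * cinner x y"
    and inner_eq_Re_cinner: "inner x y = Re (cinner x y)"

instantiation complex :: complex_hilbert
begin
definition "scaleC (c::complex) (x::complex) = c * x"
definition "cinner (x::complex) (y::complex) = cnj x * y"
instance
  by standard (auto simp: scaleC_complex_def cinner_complex_def algebra_simps
      scaleR_conv_of_real inner_complex_def)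
end

instantiation "fun" :: (type, real_vector) real_vector
begin
definition "scaleR r (f :: 'a \<Rightarrow> 'b) = (\<lambda>x. r *\<^sub>R f x)"
instance
  by standard (auto simp: scaleR_fun_def fun_eq_iff scaleR_add_right scaleR_add_left)
end

definition cspan :: "'a::complex_vec set \<Rightarrow> 'a set" where
  "cspan S = span {c *\<^sub>C x | c x. x \<in> S}"

text \<open>
  Maps which are linear on a subspace of the ambient type, for prescribed multiplications
  by complex scalars.
\<close>

definition real_linear_on :: "'a::real_vector set \<Rightarrow> ('a \<Rightarrow> 'b::real_vector) \<Rightarrow> bool" where
  "real_linear_on V f \<longleftrightarrow>
     (\<forall>x\<in>V. \<forall>y\<in>V. f (x + y) = f x + f y) \<and> (\<forall>c. \<forall>x\<in>V. f (c *\<^sub>R x) = c *\<^sub>R f x)"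

definition complex_linear_on ::
  "'a::real_vector set \<Rightarrow> (complex \<Rightarrow> 'a \<Rightarrow> 'a) \<Rightarrow> (complex \<Rightarrow> 'b::real_vector \<Rightarrow> 'b) \<Rightarrow> ('a \<Rightarrow> 'b) \<Rightarrow> bool" where
  "complex_linear_on V cm cm' f \<longleftrightarrow>
     (\<forall>x\<in>V. \<forall>y\<in>V. f (x + y) = f x + f y) \<and> (\<forall>c. \<forall>x\<in>V. f (cm c x) = cm' c (f x))"

definition bounded_complex_linear :: "('a::complex_hilbert \<Rightarrow> 'b::complex_hilbert) \<Rightarrow> bool" where
  "bounded_complex_linear f \<longleftrightarrow> bounded_linear f \<and> (\<forall>c x. f (c *\<^sub>C x) = c *\<^sub>C f x)"

definition real_orthonormal_basis :: "'a::{real_inner, complete_space} set \<Rightarrow> bool" where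
  "real_orthonormal_basis S \<longleftrightarrow>
     (\<forall>x\<in>S. \<forall>y\<in>S. inner x y = (if x = y then 1 else 0)) \<and> closure (span S) = UNIV"

definition complex_orthonormal_basis :: "'a::complex_hilbert set \<Rightarrow> bool" where
  "complex_orthonormal_basis S \<longleftrightarrow>
     (\<forall>x\<in>S. \<forall>y\<in>S. cinner x y = (if x = y then 1 else 0)) \<and> closure (cspan S) = UNIV"

definition hilbert_schmidt :: "('a::complex_hilbert \<Rightarrow> 'b::complex_hilbert) \<Rightarrow> bool" where
  "hilbert_schmidt f \<longleftrightarrow> bounded_complex_linear f \<and>
     (\<exists>S. complex_orthonormal_basis S \<and> (\<lambda>e. (norm (f e))\<^sup>2) summable_on S)"

text \<open>
  The Hilbert space tensor product of a complex and a real Hilbert space, given by its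
  bilinear map of elementary tensors (it is unique up to unitary isomorphism).
\<close>

definition hilbert_tensor ::
  "('a::complex_hilbert \<Rightarrow> 'b::{real_inner, complete_space} \<Rightarrow> 'c::complex_hilbert) \<Rightarrow> bool" where
  "hilbert_tensor tens \<longleftrightarrow>
     (\<forall>x y b. tens (x + y) b = tens x b + tens y b) \<and>
     (\<forall>c x b. tens (c *\<^sub>C x) b = c *\<^sub>C tens x b) \<and>
     (\<forall>x b. \<forall>d. tens x (b + d) = tens x b + tens x d) \<and>
     (\<forall>r x b. tens x (r *\<^sub>R b) = r *\<^sub>R tens x b) \<and>
     (\<forall>x y b d. cinner (tens x b) (tens y d) = cinner x y * complex_of_real (inner b d)) \<and>
     closure (cspan {tens x b | x b. True}) = UNIV"

definition orthogonal_projection :: "'a::complex_hilbert set \<Rightarrow> 'a \<Rightarrow> 'a" where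
  "orthogonal_projection V x = (THE y. y \<in> V \<and> (\<forall>z\<in>V. cinner z (x - y) = 0))"


section \<open>Families of Hilbertian norms\<close>

definition seminorm_topology :: "'a::real_vector set \<Rightarrow> ('a \<Rightarrow> real) set \<Rightarrow> 'a topology" where
  "seminorm_topology V Q = topology_generated_by
     (insert V {{y \<in> V. q (y - x) < e} | q x e. q \<in> Q \<and> x \<in> V \<and> 0 < e})"

definition real_inner_product_on :: "'a::real_vector set \<Rightarrow> ('a \<Rightarrow> 'a \<Rightarrow> real) \<Rightarrow> bool" where
  "real_inner_product_on V ip \<longleftrightarrow>
     (\<forall>x\<in>V. real_linear_on V (ip x)) \<and>
     (\<forall>x\<in>V. \<forall>y\<in>V. ip x y = ip y x) \<and>
     (\<forall>x\<in>V. x \<noteq> 0 \<longrightarrow> 0 < ip x x)"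

definition complex_inner_product_on ::
  "'a::real_vector set \<Rightarrow> (complex \<Rightarrow> 'a \<Rightarrow> 'a) \<Rightarrow> ('a \<Rightarrow> 'a \<Rightarrow> complex) \<Rightarrow> bool" where
  "complex_inner_product_on V cm ip \<longleftrightarrow>
     (\<forall>x\<in>V. complex_linear_on V cm (*) (ip x)) \<and>
     (\<forall>x\<in>V. \<forall>y\<in>V. ip x y = cnj (ip y x)) \<and>
     (\<forall>x\<in>V. x \<noteq> 0 \<longrightarrow> 0 < Re (ip x x))"

definition ip_norm :: "('a \<Rightarrow> 'a \<Rightarrow> real) \<Rightarrow> 'a \<Rightarrow> real" where
  "ip_norm ip x = sqrt (ip x x)"

text \<open>
  The inclusion of the completion for \<open>ip'\<close> into the completion for \<open>ip\<close> is Hilbert--Schmidt: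
  since \<open>V\<close> is dense, its squared Hilbert--Schmidt norm is the supremum of the sums below. For
  the real part of a complex inner product this changes the squared norm only by the factor 2.
\<close>

definition hilbert_schmidt_inclusion ::
  "'a::real_vector set \<Rightarrow> ('a \<Rightarrow> 'a \<Rightarrow> real) \<Rightarrow> ('a \<Rightarrow> 'a \<Rightarrow> real) \<Rightarrow> bool" where
  "hilbert_schmidt_inclusion V ip' ip \<longleftrightarrow>
     (\<exists>C. \<forall>S. finite S \<and> S \<subseteq> V \<and> (\<forall>x\<in>S. \<forall>y\<in>S. ip' x y = (if x = y then 1 else 0))
        \<longrightarrow> (\<Sum>x\<in>S. ip x x) \<le> C)"

text \<open>
  The third condition says that the continuous extension of the identity to the completions
  for consecutive norms is injective, i.e. that the completions are nested. As the composition
  of two Hilbert--Schmidt maps is nuclear, inclusions between distant enough completions are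
  also nuclear.
\<close>

definition nested_hilbertian_norms ::
  "'a::real_vector set \<Rightarrow> (nat \<Rightarrow> 'a \<Rightarrow> 'a \<Rightarrow> real) \<Rightarrow> bool" where
  "nested_hilbertian_norms V ip \<longleftrightarrow>
     (\<forall>m. real_inner_product_on V (ip m)) \<and>
     (\<forall>m. \<forall>x\<in>V. ip_norm (ip m) x \<le> ip_norm (ip (Suc m)) x) \<and>
     (\<forall>m X. range X \<subseteq> V \<and>
        (\<forall>e>0. \<exists>N. \<forall>i\<ge>N. \<forall>j\<ge>N. ip_norm (ip (Suc m)) (X i - X j) < e) \<and>
        (\<lambda>i. ip_norm (ip m) (X i)) \<longlonglongrightarrow> 0
        \<longrightarrow> (\<lambda>i. ip_norm (ip (Suc m)) (X i)) \<longlonglongrightarrow> 0) \<and>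
     (\<forall>m. \<exists>l. \<forall>k\<ge>l. hilbert_schmidt_inclusion V (ip k) (ip m))"

text \<open>
  A Hilbert space completion is given by the canonical map \<open>j\<close> into a complete space.
\<close>

definition real_hilbert_completion ::
  "'a::real_vector set \<Rightarrow> ('a \<Rightarrow> 'a \<Rightarrow> real) \<Rightarrow> ('a \<Rightarrow> 'h::{real_inner, complete_space}) \<Rightarrow> bool" where
  "real_hilbert_completion V ip j \<longleftrightarrow>
     real_linear_on V j \<and> (\<forall>x\<in>V. \<forall>y\<in>V. inner (j x) (j y) = ip x y) \<and> closure (j ` V) = UNIV"

definition complex_hilbert_completion ::
  "'a::real_vector set \<Rightarrow> (complex \<Rightarrow> 'a \<Rightarrow> 'a) \<Rightarrow> ('a \<Rightarrow> 'a \<Rightarrow> complex)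
     \<Rightarrow> ('a \<Rightarrow> 'h::complex_hilbert) \<Rightarrow> bool" where
  "complex_hilbert_completion V cm ip j \<longleftrightarrow>
     complex_linear_on V cm scaleC j \<and> (\<forall>x\<in>V. \<forall>y\<in>V. cinner (j x) (j y) = ip x y) \<and>
     closure (j ` V) = UNIV"


section \<open>Smooth functions on subsets of coordinate space\<close>

text \<open>
  Real coordinate space of dimension \<open>d\<close> consists of the sequences supported in \<open>{..<d}\<close>, as in
  the library's \<open>Euclidean_space\<close>; this includes \<open>d = 0\<close>. Partial derivatives are taken
  within the domain \<open>D\<close>, hence they are one-sided at boundary points of (products of) half-spaces.
\<close>

type_synonym coords = "nat \<Rightarrow> real"

definition coord_space :: "nat \<Rightarrow> coords set" where
  "coord_space d = {x. \<forall>i\<ge>d. x i = 0}"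

definition half_space :: "nat \<Rightarrow> coords set" where
  "half_space d = {x \<in> coord_space d. 0 \<le> x 0}"

definition partial_deriv :: "coords set \<Rightarrow> nat \<Rightarrow> (coords \<Rightarrow> real) \<Rightarrow> coords \<Rightarrow> real" where
  "partial_deriv D i f x =
     vector_derivative (\<lambda>t. f (x(i := t))) (at (x i) within {t. x(i := t) \<in> D})"

fun partial_derivs :: "coords set \<Rightarrow> nat list \<Rightarrow> (coords \<Rightarrow> real) \<Rightarrow> coords \<Rightarrow> real" where
  "partial_derivs D [] f = f"
| "partial_derivs D (i # is) f = partial_deriv D i (partial_derivs D is f)"

definition smooth_fun :: "nat \<Rightarrow> coords set \<Rightarrow> (coords \<Rightarrow> real) \<Rightarrow> bool" where
  "smooth_fun d D f \<longleftrightarrow> (\<forall>is. set is \<subseteq> {..<d} \<longrightarrow>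
     continuous_on D (partial_derivs D is f) \<and>
     (\<forall>i<d. \<forall>x\<in>D. (\<lambda>t. partial_derivs D is f (x(i := t))) differentiable
        (at (x i) within {t. x(i := t) \<in> D})))"

definition coord_lebesgue :: "nat \<Rightarrow> coords measure" where
  "coord_lebesgue d = distr (Pi\<^sub>M {..<d} (\<lambda>_. lborel)) borel (\<lambda>x i. if i < d then x i else 0)"

definition finite_cone :: "nat \<Rightarrow> coords \<Rightarrow> coords \<Rightarrow> real \<Rightarrow> real \<Rightarrow> coords set" where
  "finite_cone d x v \<rho> \<alpha> = {x + y | y. y \<in> coord_space d \<and> L2_set y {..<d} \<le> \<rho> \<and>
     (\<Sum>i<d. y i * v i) \<ge> L2_set y {..<d} * cos \<alpha>}"


section \<open>Manifolds with boundary, affine bundles and their sections\<close>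

type_synonym 'x chart = "'x set \<times> ('x \<Rightarrow> coords)"
type_synonym ('x, 'e) triv = "'x set \<times> ('e \<Rightarrow> coords)"

text \<open>
  The base manifold is the whole type \<open>'x\<close>, the total space of the affine bundle is the type
  \<open>'e\<close>, with fibre coordinates given by local trivializations.
\<close>

record ('x, 'e) geometry =
  mdim :: nat
  charts :: "'x chart set"
  orient :: "'x chart \<Rightarrow> 'x \<Rightarrow> real"
  rank :: nat
  proj :: "'e \<Rightarrow> 'x"
  trivs :: "('x, 'e) triv set"

definition smooth_on_mfd :: "('x::t2_space, 'e) geometry \<Rightarrow> 'x set \<Rightarrow> ('x \<Rightarrow> real) \<Rightarrow> bool" where
  "smooth_on_mfd \<Gamma> U f \<longleftrightarrow> (\<forall>(V, \<phi>) \<in> charts \<Gamma>.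
     smooth_fun (mdim \<Gamma>) (\<phi> ` (U \<inter> V)) (\<lambda>y. f (inv_into V \<phi> y)))"

definition mfd_boundary :: "('x::t2_space, 'e) geometry \<Rightarrow> 'x set" where
  "mfd_boundary \<Gamma> = {x. 0 < mdim \<Gamma> \<and> (\<exists>(V, \<phi>) \<in> charts \<Gamma>. x \<in> V \<and> \<phi> x 0 = 0)}"

definition jacobian :: "('x::t2_space, 'e) geometry \<Rightarrow> 'x chart \<Rightarrow> 'x chart \<Rightarrow> 'x \<Rightarrow> real" where
  "jacobian \<Gamma> c c' x = (let V = fst c; \<phi> = snd c; V' = fst c'; \<phi>' = snd c' in
     \<Sum>p | p permutes {..<mdim \<Gamma>}. of_int (sign p) * (\<Prod>i<mdim \<Gamma>.
       partial_deriv (\<phi> ` (V \<inter> V')) (p i) (\<lambda>y. \<phi>' (inv_into V \<phi> y) i) (\<phi> x)))"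

definition smooth_manifold :: "('x::t2_space, 'e) geometry \<Rightarrow> bool" where
  "smooth_manifold \<Gamma> \<longleftrightarrow>
     (\<forall>(V, \<phi>) \<in> charts \<Gamma>. open V \<and>
        openin (top_of_set (half_space (mdim \<Gamma>))) (\<phi> ` V) \<and>
        homeomorphism V (\<phi> ` V) \<phi> (inv_into V \<phi>)) \<and>
     (\<Union>(V, \<phi>) \<in> charts \<Gamma>. V) = UNIV \<and>
     (\<forall>(V, \<phi>) \<in> charts \<Gamma>. \<forall>i < mdim \<Gamma>. smooth_on_mfd \<Gamma> V (\<lambda>x. \<phi> x i))"

text \<open>
  An orientation assigns locally constant signs to the charts, compatible with the Jacobian
  determinants of the chart transitions.
\<close>

definition oriented :: "('x::t2_space, 'e) geometry \<Rightarrow> bool" where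
  "oriented \<Gamma> \<longleftrightarrow>
     (\<forall>c \<in> charts \<Gamma>. continuous_on (fst c) (orient \<Gamma> c) \<and> orient \<Gamma> c ` fst c \<subseteq> {1, -1}) \<and>
     (\<forall>c \<in> charts \<Gamma>. \<forall>c' \<in> charts \<Gamma>. \<forall>x \<in> fst c \<inter> fst c'.
        sgn (jacobian \<Gamma> c c' x) = orient \<Gamma> c x * orient \<Gamma> c' x)"

text \<open>
  The cone property in local coordinates at boundary points: every nearby point is the vertex
  of a cone in the domain, congruent to a fixed finite cone.
\<close>

definition cone_property :: "('x::t2_space, 'e) geometry \<Rightarrow> bool" where
  "cone_property \<Gamma> \<longleftrightarrow> (\<forall>p \<in> mfd_boundary \<Gamma>. \<exists>(V, \<phi>) \<in> charts \<Gamma>. \<exists>N \<rho> \<alpha>.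
     open N \<and> p \<in> N \<and> N \<subseteq> V \<and> 0 < \<rho> \<and> 0 < \<alpha> \<and> \<alpha> < pi / 2 \<and>
     (\<forall>x\<in>N. \<exists>v \<in> coord_space (mdim \<Gamma>). L2_set v {..<mdim \<Gamma>} = 1 \<and>
        finite_cone (mdim \<Gamma>) (\<phi> x) v \<rho> \<alpha> \<subseteq> \<phi> ` V))"

definition affine_bundle :: "('x::t2_space, 'e) geometry \<Rightarrow> bool" where
  "affine_bundle \<Gamma> \<longleftrightarrow>
     (\<forall>(U, \<Phi>) \<in> trivs \<Gamma>. open U \<and>
        (\<forall>x\<in>U. bij_betw \<Phi> {e. proj \<Gamma> e = x} (coord_space (rank \<Gamma>)))) \<and>
     (\<Union>(U, \<Phi>) \<in> trivs \<Gamma>. U) = UNIV \<and>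
     (\<forall>(U, \<Phi>) \<in> trivs \<Gamma>. \<forall>(U', \<Phi>') \<in> trivs \<Gamma>. \<exists>g h.
        (\<forall>a < rank \<Gamma>. smooth_on_mfd \<Gamma> (U \<inter> U') (\<lambda>x. h x a)) \<and>
        (\<forall>a < rank \<Gamma>. \<forall>b < rank \<Gamma>. smooth_on_mfd \<Gamma> (U \<inter> U') (\<lambda>x. g x a b)) \<and>
        (\<forall>e. proj \<Gamma> e \<in> U \<inter> U' \<longrightarrow> (\<forall>a < rank \<Gamma>.
           \<Phi>' e a = (\<Sum>b < rank \<Gamma>. g (proj \<Gamma> e) a b * \<Phi> e b) + h (proj \<Gamma> e) a)))"

definition affine_sections :: "('x::t2_space, 'e) geometry \<Rightarrow> ('x \<Rightarrow> 'e) set" where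
  "affine_sections \<Gamma> = {\<psi>. (\<forall>x. proj \<Gamma> (\<psi> x) = x) \<and>
     (\<forall>(U, \<Phi>) \<in> trivs \<Gamma>. \<forall>a < rank \<Gamma>. smooth_on_mfd \<Gamma> U (\<lambda>x. \<Phi> (\<psi> x) a))}"

text \<open>
  A vector of the subordinate vector bundle at \<open>x\<close> is a translation of the affine fibre over
  \<open>x\<close>. Its coordinates \<open>v\<close>, \<open>v'\<close> in two trivializations are those of the difference of two
  points of that fibre. A section of the vector bundle is represented by the family of its local
  coordinate functions.
\<close>

definition same_vector ::
  "('x::t2_space, 'e) geometry \<Rightarrow> ('x, 'e) triv \<Rightarrow> ('x, 'e) triv \<Rightarrow> 'x \<Rightarrow> coords \<Rightarrow> coords \<Rightarrow> bool" where
  "same_vector \<Gamma> \<tau> \<tau>' x v v' \<longleftrightarrow> (\<exists>e e'. proj \<Gamma> e = x \<and> proj \<Gamma> e' = x \<and>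
     v = snd \<tau> e' - snd \<tau> e \<and> v' = snd \<tau>' e' - snd \<tau>' e)"

type_synonym ('x, 'e) vsec = "('x, 'e) triv \<Rightarrow> 'x \<Rightarrow> coords"

definition vector_sections :: "('x::t2_space, 'e) geometry \<Rightarrow> ('x, 'e) vsec set" where
  "vector_sections \<Gamma> = {\<delta>.
     (\<forall>\<tau> x a. \<tau> \<notin> trivs \<Gamma> \<or> x \<notin> fst \<tau> \<or> rank \<Gamma> \<le> a \<longrightarrow> \<delta> \<tau> x a = 0) \<and>
     (\<forall>\<tau> \<in> trivs \<Gamma>. \<forall>a < rank \<Gamma>. smooth_on_mfd \<Gamma> (fst \<tau>) (\<lambda>x. \<delta> \<tau> x a)) \<and>
     (\<forall>\<tau> \<in> trivs \<Gamma>. \<forall>\<tau>' \<in> trivs \<Gamma>. \<forall>x \<in> fst \<tau> \<inter> fst \<tau>'.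
        same_vector \<Gamma> \<tau> \<tau>' x (\<delta> \<tau> x) (\<delta> \<tau>' x))}"

definition section_diff :: "('x::t2_space, 'e) geometry \<Rightarrow> ('x \<Rightarrow> 'e) \<Rightarrow> ('x \<Rightarrow> 'e) \<Rightarrow> ('x, 'e) vsec" where
  "section_diff \<Gamma> \<psi> \<psi>\<^sub>0 =
     (\<lambda>\<tau> x. if \<tau> \<in> trivs \<Gamma> \<and> x \<in> fst \<tau> then snd \<tau> (\<psi> x) - snd \<tau> (\<psi>\<^sub>0 x) else 0)"

definition local_deriv ::
  "('x::t2_space, 'e) geometry \<Rightarrow> 'x chart \<Rightarrow> ('x, 'e) triv \<Rightarrow> nat list \<Rightarrow> nat
     \<Rightarrow> ('x, 'e) vsec \<Rightarrow> coords \<Rightarrow> real" where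
  "local_deriv \<Gamma> c \<tau> is a \<delta> =
     partial_derivs (snd c ` (fst c \<inter> fst \<tau>)) is (\<lambda>y. \<delta> \<tau> (inv_into (fst c) (snd c) y) a)"

definition smooth_topology :: "('x::t2_space, 'e) geometry \<Rightarrow> ('x, 'e) vsec topology" where
  "smooth_topology \<Gamma> = seminorm_topology (vector_sections \<Gamma>)
     {(\<lambda>\<delta>. SUP x\<in>C. \<bar>local_deriv \<Gamma> c \<tau> is a \<delta> (snd c x)\<bar>) | c \<tau> C is a.
        c \<in> charts \<Gamma> \<and> \<tau> \<in> trivs \<Gamma> \<and> compact C \<and> C \<noteq> {} \<and> C \<subseteq> fst c \<inter> fst \<tau> \<and>
        set is \<subseteq> {..<mdim \<Gamma>} \<and> a < rank \<Gamma>}"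

definition boundary_flat_sections :: "('x::t2_space, 'e) geometry \<Rightarrow> ('x, 'e) vsec set" where
  "boundary_flat_sections \<Gamma> = {\<delta> \<in> vector_sections \<Gamma>.
     \<forall>c \<in> charts \<Gamma>. \<forall>\<tau> \<in> trivs \<Gamma>. \<forall>x \<in> fst c \<inter> fst \<tau> \<inter> mfd_boundary \<Gamma>. \<forall>is. \<forall>a < rank \<Gamma>.
        set is \<subseteq> {..<mdim \<Gamma>} \<longrightarrow> local_deriv \<Gamma> c \<tau> is a \<delta> (snd c x) = 0}"

text \<open>
  Squared Sobolev norms of order \<open>k\<close> (all derivatives up to order \<open>k\<close> in \<open>L\<^sup>2\<close>), computed on a
  finite family of compact coordinate patches covering the manifold.
\<close>

definition sobolev_patches ::
  "('x::t2_space, 'e) geometry \<Rightarrow> ('x chart \<times> ('x, 'e) triv \<times> 'x set) set \<Rightarrow> bool" where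
  "sobolev_patches \<Gamma> P \<longleftrightarrow> finite P \<and> (\<Union>(c, \<tau>, C) \<in> P. C) = UNIV \<and>
     (\<forall>(c, \<tau>, C) \<in> P. c \<in> charts \<Gamma> \<and> \<tau> \<in> trivs \<Gamma> \<and> compact C \<and> C \<subseteq> fst c \<inter> fst \<tau>)"

definition sobolev_sq ::
  "('x::t2_space, 'e) geometry \<Rightarrow> ('x chart \<times> ('x, 'e) triv \<times> 'x set) set \<Rightarrow> nat \<Rightarrow> ('x, 'e) vsec \<Rightarrow> real" where
  "sobolev_sq \<Gamma> P k \<delta> = (\<Sum>(c, \<tau>, C) \<in> P. \<Sum>is | set is \<subseteq> {..<mdim \<Gamma>} \<and> length is \<le> k. \<Sum>a < rank \<Gamma>.
     (LINT y : snd c ` C | coord_lebesgue (mdim \<Gamma>). (local_deriv \<Gamma> c \<tau> is a \<delta> y)\<^sup>2))"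

definition sobolev_type :: "'a set \<Rightarrow> (nat \<Rightarrow> 'a \<Rightarrow> real) \<Rightarrow> ('a \<Rightarrow> 'a \<Rightarrow> real) \<Rightarrow> bool" where
  "sobolev_type V sob ip \<longleftrightarrow> (\<exists>k b B. 0 < b \<and> (\<forall>x\<in>V. b * sob k x \<le> ip x x \<and> ip x x \<le> B * sob k x))"


section \<open>Smoothing operators\<close>

definition smooth_measure :: "('x::t2_space, 'e) geometry \<Rightarrow> 'x measure \<Rightarrow> bool" where
  "smooth_measure \<Gamma> \<mu> \<longleftrightarrow> sets \<mu> = sets borel \<and> (\<forall>(V, \<phi>) \<in> charts \<Gamma>. \<exists>\<rho>.
     smooth_fun (mdim \<Gamma>) (\<phi> ` V) \<rho> \<and> (\<forall>y \<in> \<phi> ` V. 0 < \<rho> y) \<and>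
     (\<forall>S \<in> sets borel. S \<subseteq> V \<longrightarrow>
        emeasure \<mu> S = (\<integral>\<^sup>+ y. ennreal (\<rho> y) * indicator (\<phi> ` S) y \<partial>coord_lebesgue (mdim \<Gamma>))))"

text \<open>
  \<open>\<kappa> \<tau> \<sigma> x y\<close> is the matrix of the kernel, mapping coordinates at \<open>y\<close> in the trivialization \<open>\<sigma>\<close>
  to coordinates at \<open>x\<close> in the trivialization \<open>\<tau>\<close>. For smoothness in \<open>(x, y)\<close>, pairs of points of
  \<open>d\<close>-dimensional coordinate space are identified with points of \<open>2 d\<close>-dimensional coordinate space.
\<close>

type_synonym ('x, 'e) kernel = "('x, 'e) triv \<Rightarrow> ('x, 'e) triv \<Rightarrow> 'x \<Rightarrow> 'x \<Rightarrow> nat \<Rightarrow> nat \<Rightarrow> real"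

definition matrix_app :: "nat \<Rightarrow> (nat \<Rightarrow> nat \<Rightarrow> real) \<Rightarrow> coords \<Rightarrow> coords" where
  "matrix_app r Q v = (\<lambda>a. if a < r then \<Sum>b<r. Q a b * v b else 0)"

definition fst_coords :: "nat \<Rightarrow> coords \<Rightarrow> coords" where
  "fst_coords d z = (\<lambda>i. if i < d then z i else 0)"

definition snd_coords :: "nat \<Rightarrow> coords \<Rightarrow> coords" where
  "snd_coords d z = (\<lambda>i. if i < d then z (d + i) else 0)"

definition smooth_kernel :: "('x::t2_space, 'e) geometry \<Rightarrow> ('x, 'e) kernel \<Rightarrow> bool" where
  "smooth_kernel \<Gamma> \<kappa> \<longleftrightarrow>
     (\<forall>\<tau> \<in> trivs \<Gamma>. \<forall>\<sigma> \<in> trivs \<Gamma>. \<forall>(V, \<phi>) \<in> charts \<Gamma>. \<forall>(V', \<phi>') \<in> charts \<Gamma>.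
        \<forall>a < rank \<Gamma>. \<forall>b < rank \<Gamma>.
          smooth_fun (2 * mdim \<Gamma>)
            {z \<in> coord_space (2 * mdim \<Gamma>). fst_coords (mdim \<Gamma>) z \<in> \<phi> ` (fst \<tau> \<inter> V) \<and>
               snd_coords (mdim \<Gamma>) z \<in> \<phi>' ` (fst \<sigma> \<inter> V')}
            (\<lambda>z. \<kappa> \<tau> \<sigma> (inv_into V \<phi> (fst_coords (mdim \<Gamma>) z)) (inv_into V' \<phi>' (snd_coords (mdim \<Gamma>) z)) a b)) \<and>
     (\<forall>\<tau> \<in> trivs \<Gamma>. \<forall>\<tau>' \<in> trivs \<Gamma>. \<forall>\<sigma> \<in> trivs \<Gamma>. \<forall>\<sigma>' \<in> trivs \<Gamma>.
        \<forall>x \<in> fst \<tau> \<inter> fst \<tau>'. \<forall>y \<in> fst \<sigma> \<inter> fst \<sigma>'. \<forall>v v'. same_vector \<Gamma> \<sigma> \<sigma>' y v v' \<longrightarrow>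
          same_vector \<Gamma> \<tau> \<tau>' x (matrix_app (rank \<Gamma>) (\<kappa> \<tau> \<sigma> x y) v) (matrix_app (rank \<Gamma>) (\<kappa> \<tau>' \<sigma>' x y) v'))"

definition properly_supported :: "('x::t2_space, 'e) geometry \<Rightarrow> ('x, 'e) kernel \<Rightarrow> bool" where
  "properly_supported \<Gamma> \<kappa> \<longleftrightarrow>
     (let S = closure {(x, y). \<exists>\<tau> \<in> trivs \<Gamma>. \<exists>\<sigma> \<in> trivs \<Gamma>. x \<in> fst \<tau> \<and> y \<in> fst \<sigma> \<and>
                (\<exists>a < rank \<Gamma>. \<exists>b < rank \<Gamma>. \<kappa> \<tau> \<sigma> x y a b \<noteq> 0)}
      in \<forall>C. compact C \<longrightarrow> compact (S \<inter> (C \<times> UNIV)) \<and> compact (S \<inter> (UNIV \<times> C)))"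

text \<open>
  The integrand does not depend on the trivialization used at \<open>y\<close>, so any may be chosen.
\<close>

definition kernel_operator ::
  "('x::t2_space, 'e) geometry \<Rightarrow> 'x measure \<Rightarrow> ('x, 'e) kernel \<Rightarrow> ('x, 'e) vsec \<Rightarrow> ('x, 'e) vsec" where
  "kernel_operator \<Gamma> \<mu> \<kappa> \<delta> = (\<lambda>\<tau> x a. if \<tau> \<in> trivs \<Gamma> \<and> x \<in> fst \<tau> then
     (LINT y|\<mu>. (let \<sigma> = (SOME \<sigma>. \<sigma> \<in> trivs \<Gamma> \<and> y \<in> fst \<sigma>)
                 in matrix_app (rank \<Gamma>) (\<kappa> \<tau> \<sigma> x y) (\<delta> \<sigma> y) a)) else 0)"

definition smoothing_operator ::
  "('x::t2_space, 'e) geometry \<Rightarrow> (('x, 'e) vsec \<Rightarrow> ('x, 'e) vsec) \<Rightarrow> bool" where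
  "smoothing_operator \<Gamma> C \<longleftrightarrow> (\<exists>\<mu> \<kappa>. smooth_measure \<Gamma> \<mu> \<and> smooth_kernel \<Gamma> \<kappa> \<and>
     properly_supported \<Gamma> \<kappa> \<and> (\<forall>\<delta> \<in> vector_sections \<Gamma>. C \<delta> = kernel_operator \<Gamma> \<mu> \<kappa> \<delta>))"


section \<open>The fields\<close>

text \<open>
  \<open>ipW m\<close> and \<open>ipT n\<close> are the scalar products of the norms with index \<open>m\<close>, \<open>n\<close> on the complexified
  field space and on the space of test field variations. \<open>Tpow n\<close> is the \<open>n\<close>-th completed tensor
  power, with elementary tensors \<open>tau\<close> (of lists of length \<open>n\<close>) and scalar products \<open>tip m n\<close>.
  \<open>Jc\<close> is the complex structure of \<open>Fcomplex\<close>, \<open>statistics\<close> are the labels 0 (bosonic) and 1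
  (fermionic), \<open>EL\<close> is the Euler--Lagrange functional and \<open>Ehat\<close> the element of the completed
  tensor product of the duals representing it around the reference field \<open>psi0\<close>.
\<close>

record ('x, 'e, 't) mds_data =
  geom :: "('x, 'e) geometry"
  FT :: "('x, 'e) vsec set"
  Freal :: "('x, 'e) vsec set"
  Fcomplex :: "('x, 'e) vsec set"
  Jc :: "('x, 'e) vsec \<Rightarrow> ('x, 'e) vsec"
  nflavors :: nat
  sector :: "nat \<Rightarrow> ('x, 'e) vsec set"
  statistics :: "nat \<Rightarrow> nat"
  ipW :: "nat \<Rightarrow> ('x, 'e) vsec \<times> ('x, 'e) vsec \<Rightarrow> ('x, 'e) vsec \<times> ('x, 'e) vsec \<Rightarrow> complex"
  ipT :: "nat \<Rightarrow> ('x, 'e) vsec \<Rightarrow> ('x, 'e) vsec \<Rightarrow> real"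
  Tpow :: "nat \<Rightarrow> 't set"
  tau :: "(('x, 'e) vsec \<times> ('x, 'e) vsec) list \<Rightarrow> 't"
  tip :: "nat \<Rightarrow> nat \<Rightarrow> 't \<Rightarrow> 't \<Rightarrow> complex"
  hbar :: real
  EL :: "('x \<Rightarrow> 'e) \<Rightarrow> ('x, 'e) vsec \<Rightarrow> real"
  psi0 :: "'x \<Rightarrow> 'e"
  Ehat :: "(nat \<Rightarrow> 't) \<Rightarrow> ('x, 'e) vsec \<Rightarrow> complex"
  Ckappa :: "('x, 'e) vsec \<Rightarrow> ('x, 'e) vsec"

definition base_setting :: "('x::t2_space, 'e, 't) mds_data \<Rightarrow> bool" where
  "base_setting K \<longleftrightarrow> (let \<Gamma> = geom K in
     compact (UNIV :: 'x set) \<and> smooth_manifold \<Gamma> \<and> oriented \<Gamma> \<and>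
     (mfd_boundary \<Gamma> \<noteq> {} \<longrightarrow> cone_property \<Gamma>) \<and> affine_bundle \<Gamma> \<and>
     FT K \<in> {vector_sections \<Gamma>, boundary_flat_sections \<Gamma>})"

definition closed_subspace :: "('x::t2_space, 'e, 't) mds_data \<Rightarrow> ('x, 'e) vsec set \<Rightarrow> bool" where
  "closed_subspace K V \<longleftrightarrow> subspace V \<and> closedin (smooth_topology (geom K)) V"

definition splitting_setting :: "('x::t2_space, 'e, 't) mds_data \<Rightarrow> bool" where
  "splitting_setting K \<longleftrightarrow> (let \<F> = vector_sections (geom K) in
     closed_subspace K (Freal K) \<and> closed_subspace K (Fcomplex K) \<and>
     Freal K \<inter> Fcomplex K = {0} \<and> (\<forall>x\<in>\<F>. \<exists>u \<in> Freal K. \<exists>v \<in> Fcomplex K. x = u + v) \<and>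
     (\<forall>u \<in> Freal K. \<forall>v \<in> Fcomplex K. u + v \<in> FT K \<longrightarrow> u \<in> FT K \<and> v \<in> FT K) \<and>
     Jc K ` Fcomplex K \<subseteq> Fcomplex K \<and> real_linear_on (Fcomplex K) (Jc K) \<and>
     (\<forall>v \<in> Fcomplex K. Jc K (Jc K v) = - v) \<and>
     continuous_map (subtopology (smooth_topology (geom K)) (Fcomplex K))
       (subtopology (smooth_topology (geom K)) (Fcomplex K)) (Jc K))"

definition flavor_setting :: "('x::t2_space, 'e, 't) mds_data \<Rightarrow> bool" where
  "flavor_setting K \<longleftrightarrow>
     (\<forall>i < nflavors K. closed_subspace K (sector K i) \<and> statistics K i \<in> {0, 1} \<and>
        (sector K i \<subseteq> Freal K \<or> sector K i \<subseteq> Fcomplex K \<and> Jc K ` sector K i \<subseteq> sector K i)) \<and>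
     (\<forall>x \<in> vector_sections (geom K). \<exists>!y. (\<forall>i < nflavors K. y i \<in> sector K i) \<and>
        (\<forall>i \<ge> nflavors K. y i = 0) \<and> x = (\<Sum>i < nflavors K. y i)) \<and>
     (\<forall>y. (\<forall>i < nflavors K. y i \<in> sector K i) \<and> (\<Sum>i < nflavors K. y i) \<in> FT K
        \<longrightarrow> (\<forall>i < nflavors K. y i \<in> FT K))"

text \<open>
  The complexified field space: the pair \<open>(a, b)\<close>, with \<open>a\<close> any field and \<open>b\<close> in the real part,
  stands for \<open>a + \<i> b\<close>, so that multiplication by \<open>\<i>\<close> maps \<open>(u + v, b)\<close> to \<open>(J v - b, u)\<close>
  for \<open>u\<close> in the real part and \<open>v\<close> in the complex part.
\<close>

definition Fcx :: "('x::t2_space, 'e, 't) mds_data \<Rightarrow> (('x, 'e) vsec \<times> ('x, 'e) vsec) set" where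
  "Fcx K = vector_sections (geom K) \<times> Freal K"

definition real_part :: "('x::t2_space, 'e, 't) mds_data \<Rightarrow> ('x, 'e) vsec \<Rightarrow> ('x, 'e) vsec" where
  "real_part K a = (THE u. u \<in> Freal K \<and> a - u \<in> Fcomplex K)"

definition cx_mult ::
  "('x::t2_space, 'e, 't) mds_data \<Rightarrow> complex \<Rightarrow> ('x, 'e) vsec \<times> ('x, 'e) vsec
     \<Rightarrow> ('x, 'e) vsec \<times> ('x, 'e) vsec" where
  "cx_mult K c w = (case w of (a, b) \<Rightarrow>
     Re c *\<^sub>R (a, b) + Im c *\<^sub>R (Jc K (a - real_part K a) - b, real_part K a))"

definition embed :: "('x, 'e) vsec \<Rightarrow> ('x, 'e) vsec \<times> ('x, 'e) vsec" where
  "embed a = (a, 0)"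

text \<open>
  The complexification of the \<open>i\<close>-th sector; the second component is trivial if the sector
  lies in the complex part.
\<close>

definition sector_cx ::
  "('x::t2_space, 'e, 't) mds_data \<Rightarrow> nat \<Rightarrow> (('x, 'e) vsec \<times> ('x, 'e) vsec) set" where
  "sector_cx K i = sector K i \<times> (sector K i \<inter> Freal K)"

definition norm_setting :: "('x::t2_space, 'e, 't) mds_data \<Rightarrow> bool" where
  "norm_setting K \<longleftrightarrow> (let \<Gamma> = geom K; ipR = (\<lambda>m x y. Re (ipW K m x y)) in
     (\<forall>m. complex_inner_product_on (Fcx K) (cx_mult K) (ipW K m)) \<and>
     nested_hilbertian_norms (Fcx K) ipR \<and>
     seminorm_topology (Fcx K) (range (\<lambda>m. ip_norm (ipR m))) =
       subtopology (prod_topology (smooth_topology \<Gamma>) (smooth_topology \<Gamma>)) (Fcx K) \<and>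
     nested_hilbertian_norms (FT K) (ipT K) \<and>
     seminorm_topology (FT K) (range (\<lambda>n. ip_norm (ipT K n))) =
       subtopology (smooth_topology \<Gamma>) (FT K) \<and>
     (\<exists>P. sobolev_patches \<Gamma> P \<and>
        (\<forall>m. sobolev_type (Fcx K) (\<lambda>k (a, b). sobolev_sq \<Gamma> P k a + sobolev_sq \<Gamma> P k b) (ipR m)) \<and>
        (\<forall>n. sobolev_type (FT K) (sobolev_sq \<Gamma> P) (ipT K n))))"


section \<open>Tensor powers and the field algebra\<close>

definition tnorm :: "('x, 'e, 't) mds_data \<Rightarrow> nat \<Rightarrow> nat \<Rightarrow> 't \<Rightarrow> real" where
  "tnorm K m n t = sqrt (Re (tip K m n t t))"

text \<open>
  The \<open>n\<close>-th completed tensor power is the completion of the algebraic tensor power in the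
  Hilbertian cross norms, which determines it up to isomorphism.
\<close>

definition tensor_setting :: "('x::t2_space, 'e, 't::complex_vec) mds_data \<Rightarrow> bool" where
  "tensor_setting K \<longleftrightarrow> (\<forall>n.
     subspace (Tpow K n) \<and> (\<forall>c. \<forall>t \<in> Tpow K n. c *\<^sub>C t \<in> Tpow K n) \<and>
     (\<forall>m. complex_inner_product_on (Tpow K n) scaleC (tip K m n)) \<and>
     (\<forall>xs. length xs = n \<and> set xs \<subseteq> Fcx K \<longrightarrow> tau K xs \<in> Tpow K n) \<and>
     (\<forall>us x y vs. set us \<subseteq> Fcx K \<and> x \<in> Fcx K \<and> y \<in> Fcx K \<and> set vs \<subseteq> Fcx K \<longrightarrow>
        tau K (us @ (x + y) # vs) = tau K (us @ x # vs) + tau K (us @ y # vs) \<and>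
        (\<forall>c. tau K (us @ cx_mult K c x # vs) = c *\<^sub>C tau K (us @ x # vs))) \<and>
     (\<forall>m xs ys. length xs = n \<and> length ys = n \<and> set xs \<subseteq> Fcx K \<and> set ys \<subseteq> Fcx K \<longrightarrow>
        tip K m n (tau K xs) (tau K ys) = (\<Prod>i<n. ipW K m (xs ! i) (ys ! i))) \<and>
     (\<forall>t \<in> Tpow K n. \<forall>m. \<forall>e>0.
        \<exists>u \<in> cspan {tau K xs | xs. length xs = n \<and> set xs \<subseteq> Fcx K}. tnorm K m n (t - u) < e) \<and>
     (\<forall>X. range X \<subseteq> Tpow K n \<and>
        (\<forall>m. \<forall>e>0. \<exists>N. \<forall>i\<ge>N. \<forall>j\<ge>N. tnorm K m n (X i - X j) < e) \<longrightarrow>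
        (\<exists>t \<in> Tpow K n. \<forall>m. (\<lambda>i. tnorm K m n (X i - t)) \<longlonglongrightarrow> 0)))"

definition tensor_topology :: "('x, 'e, 't::complex_vec) mds_data \<Rightarrow> nat \<Rightarrow> 't topology" where
  "tensor_topology K n = seminorm_topology (Tpow K n) (range (\<lambda>m. tnorm K m n))"

text \<open>
  The continuous linear operator between tensor powers with values \<open>g\<close> on the elementary
  tensors of lists over \<open>X\<close>; it is unique on \<^term>\<open>Tpow K n\<close> if these tensors are total.
\<close>

definition tensor_operator ::
  "('x, 'e, 't::complex_vec) mds_data \<Rightarrow> (('x, 'e) vsec \<times> ('x, 'e) vsec) set \<Rightarrow> nat \<Rightarrow> nat
     \<Rightarrow> ((('x, 'e) vsec \<times> ('x, 'e) vsec) list \<Rightarrow> 't) \<Rightarrow> 't \<Rightarrow> 't" where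
  "tensor_operator K X n n' g = (SOME f.
     complex_linear_on (Tpow K n) scaleC scaleC f \<and>
     continuous_map (tensor_topology K n) (tensor_topology K n') f \<and>
     (\<forall>xs. length xs = n \<and> set xs \<subseteq> X \<longrightarrow> f (tau K xs) = g xs))"

definition flavor :: "('x::t2_space, 'e, 't) mds_data \<Rightarrow> ('x, 'e) vsec \<times> ('x, 'e) vsec \<Rightarrow> nat" where
  "flavor K x = (LEAST i. i < nflavors K \<and> x \<in> sector_cx K i)"

text \<open>Parity of the number of inversions among the factors of flavor \<open>i\<close>.\<close>

definition sector_parity ::
  "('x::t2_space, 'e, 't) mds_data \<Rightarrow> (nat \<Rightarrow> nat) \<Rightarrow> (('x, 'e) vsec \<times> ('x, 'e) vsec) list \<Rightarrow> nat \<Rightarrow> nat" where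
  "sector_parity K \<pi> xs i = card {(a, b). a < b \<and> b < length xs \<and>
     flavor K (xs ! \<pi> a) = i \<and> flavor K (xs ! \<pi> b) = i \<and> \<pi> b < \<pi> a} mod 2"

definition perm_operator ::
  "('x::t2_space, 'e, 't::complex_vec) mds_data \<Rightarrow> nat \<Rightarrow> (nat \<Rightarrow> nat) \<Rightarrow> 't \<Rightarrow> 't" where
  "perm_operator K n \<pi> = tensor_operator K (\<Union>i < nflavors K. sector_cx K i) n n
     (\<lambda>xs. (-1) ^ (\<Sum>i < nflavors K. statistics K i * sector_parity K \<pi> xs i)
        *\<^sub>R tau K (permute_list \<pi> xs))"

definition Psym :: "('x::t2_space, 'e, 't::complex_vec) mds_data \<Rightarrow> nat \<Rightarrow> 't \<Rightarrow> 't" where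
  "Psym K n t = (1 / fact n) *\<^sub>R (\<Sum>\<pi> | \<pi> permutes {..<n}. perm_operator K n \<pi> t)"

definition field_algebra :: "('x::t2_space, 'e, 't::complex_vec) mds_data \<Rightarrow> (nat \<Rightarrow> 't) set" where
  "field_algebra K = {G. (\<forall>n. G n \<in> Tpow K n) \<and>
     (\<forall>m. summable (\<lambda>n. 2 ^ (m * n) * (tnorm K m n (G n))\<^sup>2)) \<and>
     (\<forall>n. Psym K n (G n) = G n)}"

definition alg_scale :: "complex \<Rightarrow> (nat \<Rightarrow> 't::complex_vec) \<Rightarrow> nat \<Rightarrow> 't" where
  "alg_scale c G = (\<lambda>n. c *\<^sub>C G n)"

definition alg_ip :: "('x, 'e, 't) mds_data \<Rightarrow> nat \<Rightarrow> (nat \<Rightarrow> 't) \<Rightarrow> (nat \<Rightarrow> 't) \<Rightarrow> complex" where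
  "alg_ip K m G G' = (\<Sum>n. 2 ^ (m * n) * tip K m n (G n) (G' n))"

definition alg_norm :: "('x, 'e, 't) mds_data \<Rightarrow> nat \<Rightarrow> (nat \<Rightarrow> 't) \<Rightarrow> real" where
  "alg_norm K m G = sqrt (\<Sum>n. 2 ^ (m * n) * (tnorm K m n (G n))\<^sup>2)"

definition alg_topology :: "('x::t2_space, 'e, 't::complex_vec) mds_data \<Rightarrow> (nat \<Rightarrow> 't) topology" where
  "alg_topology K = seminorm_topology (field_algebra K) (range (alg_norm K))"


section \<open>The regularized master Dyson--Schwinger operator\<close>

definition homogeneous :: "nat \<Rightarrow> 't::zero \<Rightarrow> nat \<Rightarrow> 't" where
  "homogeneous k t = (\<lambda>n. if n = k then t else 0)"

text \<open>
  The degree \<open>k\<close> component of a functional on the field algebra, extended to the full tensor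
  power through the projection onto (graded) symmetric tensors.
\<close>

definition component ::
  "('x::t2_space, 'e, 't::complex_vec) mds_data \<Rightarrow> ((nat \<Rightarrow> 't) \<Rightarrow> complex) \<Rightarrow> nat \<Rightarrow> 't \<Rightarrow> complex" where
  "component K p k t = p (homogeneous k (Psym K k t))"

definition contraction ::
  "('x::t2_space, 'e, 't::complex_vec) mds_data \<Rightarrow> ('t \<Rightarrow> complex) \<Rightarrow> nat \<Rightarrow> nat \<Rightarrow> 't \<Rightarrow> 't" where
  "contraction K q k n = tensor_operator K (Fcx K) (k + n) n
     (\<lambda>xs. q (tau K (take k xs)) *\<^sub>C tau K (drop k xs))"

definition left_insertion ::
  "('x::t2_space, 'e, 't::complex_vec) mds_data \<Rightarrow> ((nat \<Rightarrow> 't) \<Rightarrow> complex) \<Rightarrow> (nat \<Rightarrow> 't) \<Rightarrow> nat \<Rightarrow> 't" where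
  "left_insertion K p G n = (THE t. limitin (tensor_topology K n)
     (\<lambda>N. \<Sum>k<N. contraction K (component K p k) k n (G (k + n))) t sequentially)"

definition left_mult ::
  "('x::t2_space, 'e, 't::complex_vec) mds_data \<Rightarrow> ('x, 'e) vsec \<times> ('x, 'e) vsec \<Rightarrow> (nat \<Rightarrow> 't) \<Rightarrow> nat \<Rightarrow> 't" where
  "left_mult K u G = (\<lambda>n. case n of 0 \<Rightarrow> 0 | Suc l \<Rightarrow>
     real (Suc l) *\<^sub>R Psym K (Suc l)
       (tensor_operator K (Fcx K) l (Suc l) (\<lambda>xs. tau K (u # xs)) (G l)))"

text \<open>
  \<open>\<H>\<^sup>* \<otimes> \<FF>\<^sub>T\<^sup>*\<close> is, by nuclearity, the strong dual of the completed tensor product \<open>\<H> \<otimes> \<FF>\<^sub>T\<close>, i.e. the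
  space of jointly continuous bilinear forms on \<open>\<H> \<times> \<FF>\<^sub>T\<close>.
\<close>

definition dual_tensor ::
  "('x::t2_space, 'e, 't::complex_vec) mds_data \<Rightarrow> ((nat \<Rightarrow> 't) \<Rightarrow> ('x, 'e) vsec \<Rightarrow> complex) \<Rightarrow> bool" where
  "dual_tensor K b \<longleftrightarrow>
     (\<forall>\<delta> \<in> FT K. complex_linear_on (field_algebra K) alg_scale (*) (\<lambda>G. b G \<delta>)) \<and>
     (\<forall>G \<in> field_algebra K. real_linear_on (FT K) (b G)) \<and>
     continuous_map (prod_topology (alg_topology K) (subtopology (smooth_topology (geom K)) (FT K)))
       euclidean (\<lambda>(G, \<delta>). b G \<delta>)"

text \<open>
  The sequence of the tensor powers of a nonzero field does not have finite norms, so its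
  pairing with \<^term>\<open>Ehat\<close> is the sum of the pairings of its components.
\<close>

definition dynamics_setting :: "('x::t2_space, 'e, 't::complex_vec) mds_data \<Rightarrow> bool" where
  "dynamics_setting K \<longleftrightarrow> (let \<Gamma> = geom K; \<A> = affine_sections \<Gamma> in
     psi0 K \<in> \<A> \<and>
     (\<forall>\<psi>\<in>\<A>. real_linear_on (FT K) (EL K \<psi>)) \<and>
     (\<forall>\<psi>s \<psi> \<delta>s \<delta>. range \<psi>s \<subseteq> \<A> \<and> \<psi> \<in> \<A> \<and> range \<delta>s \<subseteq> FT K \<and> \<delta> \<in> FT K \<and>
        limitin (smooth_topology \<Gamma>) (\<lambda>k. section_diff \<Gamma> (\<psi>s k) \<psi>) 0 sequentially \<and>
        limitin (smooth_topology \<Gamma>) \<delta>s \<delta> sequentially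
        \<longrightarrow> (\<lambda>k. EL K (\<psi>s k) (\<delta>s k)) \<longlonglongrightarrow> EL K \<psi> \<delta>) \<and>
     dual_tensor K (Ehat K) \<and>
     (\<forall>\<psi>\<in>\<A>. \<forall>\<delta>\<in>FT K.
        (\<lambda>k. component K (\<lambda>G. Ehat K G \<delta>) k (tau K (replicate k (embed (section_diff \<Gamma> \<psi> (psi0 K))))))
          sums complex_of_real (EL K \<psi> \<delta>)) \<and>
     smoothing_operator \<Gamma> (Ckappa K) \<and>
     (\<forall>i < nflavors K. Ckappa K ` sector K i \<subseteq> sector K i))"

definition mds_setting :: "('x::t2_space, 'e, 't::complex_vec) mds_data \<Rightarrow> bool" where
  "mds_setting K \<longleftrightarrow> base_setting K \<and> splitting_setting K \<and> flavor_setting K \<and>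
     norm_setting K \<and> tensor_setting K \<and> dynamics_setting K"

definition mds_operator ::
  "('x::t2_space, 'e, 't::complex_vec) mds_data \<Rightarrow> (nat \<Rightarrow> 't) \<Rightarrow> ('x, 'e) vsec \<Rightarrow> nat \<Rightarrow> 't" where
  "mds_operator K G \<delta> = left_insertion K (\<lambda>G'. Ehat K G' \<delta>) G
     - alg_scale (\<i> * complex_of_real (hbar K)) (left_mult K (embed (Ckappa K \<delta>)) G)"

text \<open>
  \<open>M\<close> is a Hilbert--Schmidt operator on the Hilbert tensor product \<open>tens\<close> which extends the
  regularized operator, with respect to the canonical maps of the field algebra and the test
  field variations into their completions.
\<close>

definition mds_extension ::
  "('x::t2_space, 'e, 't::complex_vec) mds_data \<Rightarrow> ((nat \<Rightarrow> 't) \<Rightarrow> 'hm::complex_hilbert)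
     \<Rightarrow> ((nat \<Rightarrow> 't) \<Rightarrow> 'h0::complex_hilbert) \<Rightarrow> (('x, 'e) vsec \<Rightarrow> 'fn::{real_inner, complete_space})
     \<Rightarrow> ('hm \<Rightarrow> 'fn \<Rightarrow> 'ht::complex_hilbert) \<Rightarrow> ('ht \<Rightarrow> 'h0) \<Rightarrow> bool" where
  "mds_extension K jm j0 jF tens M \<longleftrightarrow> hilbert_schmidt M \<and>
     (\<forall>G \<in> field_algebra K. \<forall>\<delta> \<in> FT K. M (tens (jm G) (jF \<delta>)) = j0 (mds_operator K G \<delta>))"

definition mds_square ::
  "('hm::complex_hilbert \<Rightarrow> 'fn::{real_inner, complete_space} \<Rightarrow> 'ht::complex_hilbert)
     \<Rightarrow> ('ht \<Rightarrow> 'h0::complex_hilbert) \<Rightarrow> 'fn set \<Rightarrow> ('hm \<Rightarrow> 'hm) \<Rightarrow> bool" where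
  "mds_square tens M S Msq \<longleftrightarrow> bounded_complex_linear Msq \<and>
     (\<forall>G\<^sub>1 G\<^sub>2. ((\<lambda>e. cinner (M (tens G\<^sub>1 e)) (M (tens G\<^sub>2 e))) has_sum cinner G\<^sub>1 (Msq G\<^sub>2)) S)"

end

theory Submission
  imports Defs
begin

text \<open>
  A symmetric operator \<open>Q\<close> with \<open>0 \<le> Q \<le> I\<close> satisfies \<open>Q\<^sup>2 \<le> Q\<close>, so the moments
  \<open>a\<^sub>k = \<langle>x, Q\<^sup>k x\<rangle>\<close> decrease and converge. Since
  \<open>\<parallel>Q\<^sup>k x - Q\<^sup>l x\<parallel>\<^sup>2 = a\<^bsub>2k\<^esub> - 2 a\<^bsub>k+l\<^esub> + a\<^bsub>2l\<^esub>\<close>, the iterates \<open>Q\<^sup>k x\<close> form a Cauchy sequence.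
  Their limit is a fixed point of \<open>Q\<close>, and symmetry makes \<open>x - Q\<^sup>k x\<close> orthogonal to all fixed
  points, so the limit is the projection of \<open>x\<close> onto the fixed points. For \<open>Q = I - T\<^sup>-\<^sup>1 A\<close> these
  are the kernel of \<open>A\<close>.
\<close>

text \<open>Only the real scalar product occurs here: a complex Hilbert space enters through the
  real part of \<open>cinner\<close>, which induces the same norm.\<close>

locale symmetric_contraction =
  fixes Q :: "'a::{real_inner, complete_space} \<Rightarrow> 'a"
  assumes linear: "linear Q"
    and symmetric: "inner (Q x) y = inner x (Q y)"
    and nonneg: "0 \<le> inner x (Q x)"
    and le_one: "inner x (Q x) \<le> inner x x"
begin

text \<open>The proof uses \<open>Q - Q\<^sup>2 = Q(I - Q)Q + (I - Q)Q(I - Q)\<close>.\<close>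

lemma norm_square_le: "inner (Q x) (Q x) \<le> inner x (Q x)"
proof -
  have "0 \<le> inner (Q x) (Q x) - inner (Q x) (Q (Q x))"
    using le_one[of "Q x"] by simp
  moreover have "0 \<le> inner (x - Q x) (Q (x - Q x))"
    by (rule nonneg)
  moreover have "inner x (Q (Q x)) = inner (Q x) (Q x)"
    by (simp add: symmetric)
  ultimately show ?thesis
    by (simp add: linear_diff[OF linear] inner_diff_left inner_diff_right)
qed

lemma bounded_linear: "bounded_linear Q"
proof (rule bounded_linear_intro[where K = 1])
  fix x
  show "norm (Q x) \<le> norm x * 1"
    using order_trans[OF norm_square_le le_one, of x] by (simp add: norm_le)
qed (simp_all add: linear_add[OF linear] linear_scale[OF linear])

lemma inner_funpow: "inner ((Q ^^ k) x) ((Q ^^ l) y) = inner x ((Q ^^ (k + l)) y)"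
proof (induction k arbitrary: l)
  case (Suc k)
  show ?case
    using Suc[of "Suc l"] by (simp add: symmetric)
qed simp

text \<open>With \<open>z = (Q ^^ j) x\<close>, the moments of index \<open>2 j\<close>,
  \<open>2 j + 1\<close>, \<open>2 j + 2\<close> are \<open>inner z z\<close>,
  \<open>inner z (Q z)\<close> and \<open>inner (Q z) (Q z)\<close>; they decrease by
  \<open>le_one\<close> and \<open>norm_square_le\<close>.\<close>

lemma decseq_moments: "decseq (\<lambda>k. inner x ((Q ^^ k) x))"
proof (rule decseq_SucI)
  fix k :: nat
  obtain j where "k = j + j \<or> k = Suc (j + j)"
    by (metis evenE oddE mult_2 Suc_eq_plus1)
  then show "inner x ((Q ^^ Suc k) x) \<le> inner x ((Q ^^ k) x)"
  proof
    assume "k = j + j"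
    then show ?thesis
      using le_one[of "(Q ^^ j) x"] inner_funpow[of j x j x] inner_funpow[of j x "Suc j" x]
      by simp
  next
    assume "k = Suc (j + j)"
    then show ?thesis
      using norm_square_le[of "(Q ^^ j) x"] inner_funpow[of "Suc j" x "Suc j" x]
        inner_funpow[of j x "Suc j" x]
      by simp
  qed
qed

text \<open>Even moments are squared norms, odd ones are values of the positive form of
  \<open>Q\<close>. This lower bound makes the decreasing moments converge.\<close>

lemma moments_nonneg: "0 \<le> inner x ((Q ^^ k) x)"
proof -
  obtain j where "k = j + j \<or> k = Suc (j + j)"
    by (metis evenE oddE mult_2 Suc_eq_plus1)
  then show ?thesis
    using nonneg[of "(Q ^^ j) x"] inner_ge_zero[of "(Q ^^ j) x"]
      inner_funpow[of j x j x] inner_funpow[of j x "Suc j" x]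
    by auto
qed

lemma Cauchy_funpow: "Cauchy (\<lambda>k. (Q ^^ k) x)"
proof (rule metric_CauchyI)
  fix e :: real
  assume "0 < e"
  define a where "a k = inner x ((Q ^^ k) x)" for k
  obtain L where L: "a \<longlonglongrightarrow> L"
    using decseq_convergent[OF decseq_moments[of x], of 0] moments_nonneg[of x]
    unfolding a_def by blast
  \<comment> \<open>In the squared distance the moments have coefficients 1, -2, 1: the limit
    \<open>L\<close> cancels, and the absolute values add up to 4.\<close>
  obtain N where N: "\<bar>a k - L\<bar> < e\<^sup>2 / 4" if "k \<ge> N" for k
    using LIMSEQ_D[OF L, of "e\<^sup>2 / 4"] \<open>0 < e\<close> by auto
  have "dist ((Q ^^ k) x) ((Q ^^ l) x) < e" if "k \<ge> N" "l \<ge> N" for k l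
  proof -
    have "(dist ((Q ^^ k) x) ((Q ^^ l) x))\<^sup>2 = a (k + k) - 2 * a (k + l) + a (l + l)"
      unfolding dist_norm power2_norm_eq_inner a_def
      by (simp add: inner_diff_left inner_diff_right inner_funpow add.commute)
    also have "\<dots> < e\<^sup>2"
      using N[of "k + k"] N[of "k + l"] N[of "l + l"] that by linarith
    finally show ?thesis
      using \<open>0 < e\<close> by (simp add: power_less_imp_less_base)
  qed
  then show "\<exists>N. \<forall>k\<ge>N. \<forall>l\<ge>N. dist ((Q ^^ k) x) ((Q ^^ l) x) < e"
    by blast
qed

lemma funpow_limit:
  obtains y where "(\<lambda>k. (Q ^^ k) x) \<longlonglongrightarrow> y" "Q y = y"
    "\<And>z. Q z = z \<Longrightarrow> inner z (x - y) = 0"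
proof -
  obtain y where y: "(\<lambda>k. (Q ^^ k) x) \<longlonglongrightarrow> y"
    using Cauchy_convergent[OF Cauchy_funpow[of x]] by (auto simp: convergent_def)
  have "(\<lambda>k. (Q ^^ Suc k) x) \<longlonglongrightarrow> Q y"
    using bounded_linear.tendsto[OF bounded_linear y] by simp
  then have "Q y = y"
    using LIMSEQ_Suc[OF y] LIMSEQ_unique by blast
  moreover have "inner z (x - y) = 0" if "Q z = z" for z
  proof -
    \<comment> \<open>Symmetry shifts each \<open>Q\<close> onto the fixed vector \<open>z\<close>,
      which absorbs it.\<close>
    have "inner z ((Q ^^ k) x) = inner z x" for k
      by (induction k) (simp_all add: symmetric[symmetric] that)
    then have "(\<lambda>k. inner z x) \<longlonglongrightarrow> inner z y"
      using tendsto_inner[OF tendsto_const[of z] y] by simp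
    then show ?thesis
      by (simp add: LIMSEQ_const_iff inner_diff_right)
  qed
  ultimately show thesis
    using that y by blast
qed

end

text \<open>
  Real orthogonality to a complex subspace already is complex orthogonality, because the imaginary
  part of \<open>\<langle>z, w\<rangle>\<close> is the real scalar product of \<open>\<i>z\<close> and \<open>w\<close>.
\<close>

lemma orthogonal_projection_eqI:
  fixes V :: "'a::complex_hilbert set"
  assumes "y \<in> V"
    and diff: "\<And>u v. u \<in> V \<Longrightarrow> v \<in> V \<Longrightarrow> u - v \<in> V"
    and scale: "\<And>z. z \<in> V \<Longrightarrow> \<i> *\<^sub>C z \<in> V"
    and orth: "\<And>z. z \<in> V \<Longrightarrow> inner z (x - y) = 0"
  shows "orthogonal_projection V x = y"
  unfolding orthogonal_projection_def
proof (rule the_equality)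
  have "cinner z (x - y) = 0" if "z \<in> V" for z
  proof (rule complex_eqI)
    show "Re (cinner z (x - y)) = Re 0"
      using orth[OF that] by (simp add: inner_eq_Re_cinner)
    have "cinner (\<i> *\<^sub>C z) (x - y) = - \<i> * cinner z (x - y)"
      by (metis cinner_commute cinner_scaleC_right complex_cnj_mult complex_cnj_i)
    then show "Im (cinner z (x - y)) = Im 0"
      using orth[OF scale[OF that]] by (simp add: inner_eq_Re_cinner)
  qed
  then show "y \<in> V \<and> (\<forall>z\<in>V. cinner z (x - y) = 0)"
    using assms(1) by blast
next
  fix w
  assume w: "w \<in> V \<and> (\<forall>z\<in>V. cinner z (x - w) = 0)"
  \<comment> \<open>This vector is orthogonal to \<open>x - w\<close> and to \<open>x - y\<close>,
    hence to their difference, which is \<open>y - w\<close> itself.\<close>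
  have "y - w \<in> V"
    using assms(1) w diff by blast
  then have "inner (y - w) (x - w) = 0" "inner (y - w) (x - y) = 0"
    using w orth by (simp_all add: inner_eq_Re_cinner)
  then have "inner (y - w) ((x - w) - (x - y)) = 0"
    by (simp only: inner_diff_right)
  then show "w = y"
    by simp
qed

lemma positive_operator_iterates_tendsto_projection:
  fixes A :: "'a::complex_hilbert \<Rightarrow> 'a"
  assumes A: "bounded_complex_linear A"
    and symmetric: "\<And>x y. inner (A x) y = inner x (A y)"
    and nonneg: "\<And>x. 0 \<le> inner x (A x)"
    and T: "0 < T" "onorm A \<le> T"
  shows "(\<lambda>k. ((\<lambda>x. x - (1 / T) *\<^sub>R A x) ^^ k) x) \<longlonglongrightarrow> orthogonal_projection {x. A x = 0} x"
proof -
  define Q where "Q x = x - (1 / T) *\<^sub>R A x" for x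
  have bl: "bounded_linear A" and scaleC: "\<And>c x. A (c *\<^sub>C x) = c *\<^sub>C A x"
    using A by (auto simp: bounded_complex_linear_def)
  interpret A: bounded_linear A
    by (rule bl)
  interpret Q: symmetric_contraction Q
  proof
    fix x y
    show "Q (x + y) = Q x + Q y" "Q (r *\<^sub>R x) = r *\<^sub>R Q x" for r
      by (simp_all add: Q_def A.add A.scaleR algebra_simps)
    show "inner (Q x) y = inner x (Q y)"
      by (simp add: Q_def inner_diff_left inner_diff_right symmetric)
    show "inner x (Q x) \<le> inner x x"
      using nonneg[of x] T by (simp add: Q_def inner_diff_right)
    \<comment> \<open>Cauchy-Schwarz turns \<open>onorm A \<le> T\<close> into the form bound that
      makes \<open>Q\<close> positive.\<close>
    have "inner x (A x) \<le> norm x * norm (A x)"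
      by (rule norm_cauchy_schwarz)
    also have "\<dots> \<le> norm x * (T * norm x)"
      using onorm[OF bl, of x] T
      by (meson mult_left_mono mult_right_mono norm_ge_zero order_trans)
    also have "\<dots> = T * inner x x"
      by (simp add: power2_norm_eq_inner[symmetric] power2_eq_square)
    finally show "0 \<le> inner x (Q x)"
      using T by (simp add: Q_def inner_diff_right field_simps)
  qed
  have fix_iff: "Q z = z \<longleftrightarrow> A z = 0" for z
    using T by (simp add: Q_def)
  obtain y where y: "(\<lambda>k. (Q ^^ k) x) \<longlonglongrightarrow> y" "Q y = y"
      "\<And>z. Q z = z \<Longrightarrow> inner z (x - y) = 0"
    using Q.funpow_limit[of x] by blast
  \<comment> \<open>This makes the kernel of \<open>A\<close> closed under multiplication by
    \<i>.\<close>
  have "\<i> *\<^sub>C (0::'a) = 0"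
    using scaleC_add_right[of \<i> "0::'a" 0] by simp
  then have "orthogonal_projection {x. A x = 0} x = y"
    using y(2,3) by (intro orthogonal_projection_eqI) (auto simp: fix_iff A.diff scaleC)
  then show ?thesis
    using y(1) by (simp add: Q_def[abs_def])
qed

text \<open>Real parts may be taken termwise. The resulting Gram form shows both the symmetry and
  the positivity of \<open>A\<close>.\<close>

lemma mds_square_has_sum:
  assumes "mds_square tens M S A"
  shows "((\<lambda>e. inner (M (tens x e)) (M (tens y e))) has_sum inner x (A y)) S"
  using assms has_sum_bounded_linear[OF bounded_linear_Re]
  unfolding mds_square_def inner_eq_Re_cinner o_def by blast

lemma mds_square_symmetric:
  assumes "mds_square tens M S A"
  shows "inner (A x) y = inner x (A y)"
  using has_sum_unique[OF mds_square_has_sum[OF assms, of x y]]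
    mds_square_has_sum[OF assms, of y x]
  by (simp add: inner_commute)

lemma mds_square_nonneg:
  assumes "mds_square tens M S A"
  shows "0 \<le> inner x (A x)"
  by (rule has_sum_nonneg[OF mds_square_has_sum[OF assms]]) simp

theorem theorem34:
  fixes K :: "('x::t2_space, 'e, 't::complex_vec) mds_data"
    and m n :: nat
    and jm :: "(nat \<Rightarrow> 't) \<Rightarrow> 'hm::complex_hilbert"
    and j0 :: "(nat \<Rightarrow> 't) \<Rightarrow> 'h0::complex_hilbert"
    and jF :: "('x, 'e) vsec \<Rightarrow> 'fn::{real_inner, complete_space}"
    and tens :: "'hm \<Rightarrow> 'fn \<Rightarrow> 'ht::complex_hilbert"
    and M :: "'ht \<Rightarrow> 'h0"
    and S :: "'fn set"
    and Msq :: "'hm \<Rightarrow> 'hm"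
    and T :: real
  assumes "mds_setting K"
    and "complex_hilbert_completion (field_algebra K) alg_scale (alg_ip K m) jm"
    and "complex_hilbert_completion (field_algebra K) alg_scale (alg_ip K 0) j0"
    and "real_hilbert_completion (FT K) (ipT K n) jF"
    and "hilbert_tensor tens"
    and "mds_extension K jm j0 jF tens M"
    and "real_orthonormal_basis S"
    and "mds_square tens M S Msq"
    and "0 < T" and "onorm Msq \<le> T"
  shows "\<forall>G. (\<lambda>k. ((\<lambda>x. x - (1 / T) *\<^sub>R Msq x) ^^ k) G)
           \<longlonglongrightarrow> orthogonal_projection {x. Msq x = 0} G"
  using positive_operator_iterates_tendsto_projection[OF _
      mds_square_symmetric[OF assms(8)] mds_square_nonneg[OF assms(8)] assms(9,10)] assms(8)
  by (simp add: mds_square_def)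

end
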